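(* Let $T\ge1$ and $a_1,\dots,a_T>0$. The function $\lambda\mapsto C(\lambda;T)$ is a rational function of $\lambda$ on $\sigma_{ell}(J_T)$, and it can be extended, uniquely, as a rational function to $\mathbb{C}$.
   Context: Let $T\ge1$, $a_1,\dots,a_T>0$, extended periodically by $a_{n+T}=a_n$, so in particular $a_0=a_T$. $J_T$ is the $T$-periodic Jacobi operator on $l^2(\mathbb{N};\mathbb{C})$ with zero diagonal and off-diagonal entries $a_1,a_2,\dots$. For $\lambda\in\mathbb{C}$ and $j\in\{1,\dots,T\}$ put $$B_j(\lambda)=\begin{pmatrix}0&1\\ -\frac{a_{j-1}}{a_j}&\frac{\lambda}{a_j}\end{pmatrix},\qquad M(\lambda)=B_T(\lambda)B_{T-1}(\lambda)\cdots B_1(\lambda)=\begin{pmatrix}m_{11}(\lambda)&m_{12}(\lambda)\\ m_{21}(\lambda)&m_{22}(\lambda)\end{pmatrix}.$$ $\sigma_{ell}(J_T)$ is the set of elliptic points, i.e. of those $\lambda\in\mathbb{C}$ for which $M(\lambda)$ has two distinct eigenvalues of modulus one; equivalently, the set of real $\lambda$ with $|\mathrm{Tr}\,M(\lambda)|<2$. For $\lambda\in\sigma_{ell}(J_T)$ the eigenvalues of $M(\lambda)$ are $\mu(\lambda)=e^{i\theta(\lambda)}$ and $\overline{\mu(\lambda)}=e^{-i\theta(\lambda)}$ with $\theta(\lambda)$ real (the quasi-momentum), and $m_{12}(\lambda)\ne0$. Define $\varphi_0=1$, $\varphi_1(\lambda)=(\mu(\lambda)-m_{11}(\lambda))/m_{12}(\lambda)$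 (so that $(\varphi_0,\varphi_1)^{\top}$ is an eigenvector of $M(\lambda)$ for the eigenvalue $\mu(\lambda)$), and define $\varphi_2,\dots,\varphi_T$ by $a_{s-1}\varphi_{s-1}+a_s\varphi_{s+1}=\lambda\varphi_s$, $s=1,\dots,T-1$. For $\lambda\in\sigma_{ell}(J_T)$ set $$C(\lambda;T)=\mathrm{Re}\left(\sum_{s=1}^{T}\varphi_s(\lambda)\overline{\varphi_{s-1}(\lambda)}\right);$$ this does not depend on which of the two eigenvalues is called $\mu$. A rational function on $\mathbb{C}$ is understood to be defined away from its poles. *)

theory Defs
  imports
    Complex_Main
    "HOL-Computational_Algebra.Fraction_Field"
    "Jordan_Normal_Form.Char_Poly"
begin

text \<open>The weights form a sequence \<open>a\<close> indexed from \<open>0\<close>; the hypotheses of a theorem using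
  these definitions have to say that it is positive and \<open>T\<close>-periodic, so that \<open>a 0 = a T\<close>.\<close>

definition transfer_mat :: "(nat \<Rightarrow> real) \<Rightarrow> nat \<Rightarrow> complex \<Rightarrow> complex mat" where
  "transfer_mat a j z = mat_of_rows_list 2
     [[0, 1],
      [- (complex_of_real (a (j - 1)) / complex_of_real (a j)), z / complex_of_real (a j)]]"

text \<open>The product \<open>B\<^sub>T \<cdots> B\<^sub>1\<close>, with the factor of largest index on the left.\<close>

primrec monodromy :: "(nat \<Rightarrow> real) \<Rightarrow> nat \<Rightarrow> complex \<Rightarrow> complex mat" where
  "monodromy a 0 z = 1\<^sub>m 2"
| "monodromy a (Suc n) z = transfer_mat a (Suc n) z * monodromy a n z"

definition sigma_ell :: "(nat \<Rightarrow> real) \<Rightarrow> nat \<Rightarrow> complex set" where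
  "sigma_ell a T = {z. \<exists>\<mu> \<nu>. \<mu> \<noteq> \<nu> \<and> cmod \<mu> = 1 \<and> cmod \<nu> = 1 \<and>
     eigenvalue (monodromy a T z) \<mu> \<and> eigenvalue (monodromy a T z) \<nu>}"

text \<open>The solution of the three-term recurrence starting from the eigenvector
  \<open>(\<phi>\<^sub>0, \<phi>\<^sub>1)\<close> of the monodromy matrix for the eigenvalue \<open>\<mu>\<close>. Matrix entries are indexed from
  \<open>0\<close>, so \<open>m\<^sub>1\<^sub>1\<close> and \<open>m\<^sub>1\<^sub>2\<close> are the entries \<open>(0,0)\<close> and \<open>(0,1)\<close>. The last equation is
  \<open>a\<^sub>s\<^sub>-\<^sub>1 \<phi>\<^sub>s\<^sub>-\<^sub>1 + a\<^sub>s \<phi>\<^sub>s\<^sub>+\<^sub>1 = z \<phi>\<^sub>s\<close> with \<open>s = Suc n\<close>, solved for \<open>\<phi>\<^sub>s\<^sub>+\<^sub>1\<close>; only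
  the values up to index \<open>T\<close> are used.\<close>

fun phi :: "(nat \<Rightarrow> real) \<Rightarrow> nat \<Rightarrow> complex \<Rightarrow> complex \<Rightarrow> nat \<Rightarrow> complex" where
  "phi a T z \<mu> 0 = 1"
| "phi a T z \<mu> (Suc 0) = (\<mu> - monodromy a T z $$ (0,0)) / monodromy a T z $$ (0,1)"
| "phi a T z \<mu> (Suc (Suc n)) =
     (z * phi a T z \<mu> (Suc n) - complex_of_real (a n) * phi a T z \<mu> n)
       / complex_of_real (a (Suc n))"

text \<open>The argument \<open>\<mu>\<close> is the eigenvalue of the monodromy matrix chosen for \<open>\<phi>\<close>. It is kept
  explicit, so that no choice between the two eigenvalues is built into the definition.\<close>

definition C_fun :: "(nat \<Rightarrow> real) \<Rightarrow> nat \<Rightarrow> complex \<Rightarrow> complex \<Rightarrow> real" where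
  "C_fun a T z \<mu> = Re (\<Sum>s = 1..T. phi a T z \<mu> s * cnj (phi a T z \<mu> (s - 1)))"

text \<open>A rational function is an element of the fraction field of the polynomials. It is defined
  at \<open>z\<close>, with value \<open>w\<close>, if it has a representation as a fraction whose denominator does not
  vanish at \<open>z\<close>; the value does not depend on the representation. At a pole no \<open>w\<close> qualifies.\<close>

type_synonym rat_fun = "complex poly fract"

definition rat_has_value :: "rat_fun \<Rightarrow> complex \<Rightarrow> complex \<Rightarrow> bool" where
  "rat_has_value R z w \<longleftrightarrow>
     (\<exists>p q. R = Fract p q \<and> poly q z \<noteq> 0 \<and> w = poly p z / poly q z)"

end

theory Submission
  imports Defs "HOL-Computational_Algebra.Fundamental_Theorem_Algebra"
begin

text \<open>At a point \<open>z\<close> of the elliptic set the Wronskian identity forces \<open>z\<close> to be real, so the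
  monodromy matrix is real with determinant \<open>1\<close> and its eigenvalues are \<open>\<mu>\<close> and \<open>cnj \<mu>\<close>. Writing
  \<open>\<phi>\<^sub>s = A\<^sub>s + \<phi>\<^sub>1 B\<^sub>s\<close> with real polynomials \<open>A\<^sub>s\<close>, \<open>B\<^sub>s\<close>, the real part of
  \<open>\<phi>\<^sub>s cnj \<phi>\<^sub>s\<^sub>-\<^sub>1\<close> involves \<open>\<phi>\<^sub>1\<close> only through \<open>2 Re \<phi>\<^sub>1 = (m\<^sub>2\<^sub>2 - m\<^sub>1\<^sub>1) / m\<^sub>1\<^sub>2\<close> and
  \<open>|\<phi>\<^sub>1|\<^sup>2 = - m\<^sub>2\<^sub>1 / m\<^sub>1\<^sub>2\<close>. Uniqueness holds because the elliptic set is infinite: by the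
  fundamental theorem of algebra the trace, a nonconstant polynomial, attains every value
  \<open>2 cos \<theta>\<close>.\<close>

section \<open>Two-by-two matrices\<close>

abbreviation mat22 :: "'a \<Rightarrow> 'a \<Rightarrow> 'a \<Rightarrow> 'a \<Rightarrow> 'a mat" where
  "mat22 p q r s \<equiv> mat_of_rows_list 2 [[p, q], [r, s]]"

lemma less_two_cases: "(i::nat) < 2 \<longleftrightarrow> i = 0 \<or> i = 1"
  by auto

lemma dim_mat22 [simp]: "dim_row (mat22 p q r s) = 2" "dim_col (mat22 p q r s) = 2"
  by (simp_all add: mat_of_rows_list_def)

lemma mat22_mult:
  fixes p q r s :: "'a :: comm_semiring_1"
  shows "mat22 p q r s * mat22 p' q' r' s' =
     mat22 (p * p' + q * r') (p * q' + q * s') (r * p' + s * r') (r * q' + s * s')"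
  by (rule eq_matI)
     (auto simp: less_Suc_eq scalar_prod_def atLeast0_lessThan_Suc numeral_2_eq_2
       mat_of_rows_list_def add.commute)

lemma mat22_mult_vec:
  fixes p q r s :: "'a :: comm_semiring_1"
  assumes "v \<in> carrier_vec 2"
  shows "(mat22 p q r s *\<^sub>v v) $ 0 = p * v $ 0 + q * v $ 1"
    "(mat22 p q r s *\<^sub>v v) $ 1 = r * v $ 0 + s * v $ 1"
  using assms
  by (auto simp: scalar_prod_def atLeast0_lessThan_Suc numeral_2_eq_2
       mat_of_rows_list_def add.commute)

lemma eigenvalue_mat22:
  fixes p q r s k :: complex
  shows "eigenvalue (mat22 p q r s) k \<longleftrightarrow>
    (\<exists>x y. (x \<noteq> 0 \<or> y \<noteq> 0) \<and> p * x + q * y = k * x \<and> r * x + s * y = k * y)"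
proof
  assume "eigenvalue (mat22 p q r s) k"
  then obtain v where v: "v \<in> carrier_vec 2" "v \<noteq> 0\<^sub>v 2" "mat22 p q r s *\<^sub>v v = k \<cdot>\<^sub>v v"
    unfolding eigenvalue_def eigenvector_def by auto
  have "p * v $ 0 + q * v $ 1 = k * v $ 0" "r * v $ 0 + s * v $ 1 = k * v $ 1"
    using mat22_mult_vec[OF v(1), of p q r s] v(1) unfolding v(3) by simp_all
  moreover have "v $ 0 \<noteq> 0 \<or> v $ 1 \<noteq> 0"
  proof (rule ccontr)
    assume "\<not> ?thesis"
    then have "v = 0\<^sub>v 2" using v(1) by (intro eq_vecI) (auto simp: less_two_cases)
    then show False using v by simp
  qed
  ultimately show "\<exists>x y. (x \<noteq> 0 \<or> y \<noteq> 0) \<and> p * x + q * y = k * x \<and> r * x + s * y = k * y"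
    by blast
next
  assume "\<exists>x y. (x \<noteq> 0 \<or> y \<noteq> 0) \<and> p * x + q * y = k * x \<and> r * x + s * y = k * y"
  then obtain x y where xy: "x \<noteq> 0 \<or> y \<noteq> 0" "p * x + q * y = k * x" "r * x + s * y = k * y"
    by blast
  define v where "v = vec 2 (\<lambda>i. if i = 0 then x else y)"
  have v: "v \<in> carrier_vec 2" "v $ 0 = x" "v $ 1 = y"
    by (simp_all add: v_def)
  have "v \<noteq> 0\<^sub>v 2" using v xy(1) by auto
  moreover have "mat22 p q r s *\<^sub>v v = k \<cdot>\<^sub>v v"
  proof (rule eq_vecI)
    show "(mat22 p q r s *\<^sub>v v) $ i = (k \<cdot>\<^sub>v v) $ i" if "i < dim_vec (k \<cdot>\<^sub>v v)" for i
    proof -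
      have "i = 0 \<or> i = 1" using that v(1) by auto
      then show ?thesis
        using mat22_mult_vec[OF v(1), of p q r s] v xy(2,3) by auto
    qed
  qed (use v(1) in simp)
  ultimately show "eigenvalue (mat22 p q r s) k"
    unfolding eigenvalue_def eigenvector_def using v(1) by auto
qed

text \<open>With \<open>M\<close> the matrix, the adjugate of \<open>k - M\<close> does both
  directions: applied to \<open>(k - M) v = 0\<close> it gives \<open>det (k - M)\<close> times
  \<open>v\<close>, and if the determinant vanishes its columns are killed by
  \<open>k - M\<close>.\<close>

lemma eigenvalue_mat22_iff:
  fixes p q r s k :: complex
  shows "eigenvalue (mat22 p q r s) k \<longleftrightarrow> (k - p) * (k - s) = q * r"
proof
  assume "eigenvalue (mat22 p q r s) k"
  then obtain x y where xy: "x \<noteq> 0 \<or> y \<noteq> 0" "p * x + q * y = k * x" "r * x + s * y = k * y"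
    unfolding eigenvalue_mat22 by blast
  have e: "(k - p) * x - q * y = 0" "(k - s) * y - r * x = 0"
    using xy(2,3) by (simp_all add: left_diff_distrib flip: xy(2,3))
  have "((k - p) * (k - s) - q * r) * x = (k - s) * ((k - p) * x - q * y) + q * ((k - s) * y - r * x)"
    "((k - p) * (k - s) - q * r) * y = r * ((k - p) * x - q * y) + (k - p) * ((k - s) * y - r * x)"
    by (simp_all add: algebra_simps)
  then have "((k - p) * (k - s) - q * r) * x = 0" "((k - p) * (k - s) - q * r) * y = 0"
    unfolding e by simp_all
  then show "(k - p) * (k - s) = q * r" using xy(1) by auto
next
  assume h: "(k - p) * (k - s) = q * r"
  \<comment> \<open>The columns of the adjugate are \<open>(q, k - p)\<close> and
    \<open>(k - s, r)\<close>. If both vanish, the matrix is the scalar \<open>k\<close> and any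
    nonzero vector will do.\<close>
  consider "q \<noteq> 0 \<or> k - p \<noteq> 0" | "k - s \<noteq> 0 \<or> r \<noteq> 0"
    | "q = 0" "r = 0" "p = k" "s = k" by force
  then show "eigenvalue (mat22 p q r s) k"
  proof cases
    case 1
    then show ?thesis unfolding eigenvalue_mat22 using h
      by (intro exI[of _ q] exI[of _ "k - p"]) (auto simp: algebra_simps)
  next
    case 2
    then show ?thesis unfolding eigenvalue_mat22 using h
      by (intro exI[of _ "k - s"] exI[of _ r]) (auto simp: algebra_simps)
  next
    case 3
    then show ?thesis unfolding eigenvalue_mat22
      by (intro exI[of _ 1] exI[of _ 0]) auto
  qed
qed

section \<open>Polynomial solutions of the recurrence\<close>

text \<open>The spectral parameter is the indeterminate, and \<open>pCons 0\<close> multiplies by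
  it. The initial values do not depend on it.\<close>

fun sol_poly :: "(nat \<Rightarrow> real) \<Rightarrow> complex \<Rightarrow> complex \<Rightarrow> nat \<Rightarrow> complex poly" where
  "sol_poly a x y 0 = [:x:]"
| "sol_poly a x y (Suc 0) = [:y:]"
| "sol_poly a x y (Suc (Suc n)) = Polynomial.smult (1 / complex_of_real (a (Suc n)))
     (pCons 0 (sol_poly a x y (Suc n)) - Polynomial.smult (complex_of_real (a n)) (sol_poly a x y n))"

abbreviation solA :: "(nat \<Rightarrow> real) \<Rightarrow> nat \<Rightarrow> complex poly" where
  "solA a \<equiv> sol_poly a 1 0"

abbreviation solB :: "(nat \<Rightarrow> real) \<Rightarrow> nat \<Rightarrow> complex poly" where
  "solB a \<equiv> sol_poly a 0 1"

lemma sol_poly_superposition: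
  "poly (sol_poly a x y n) z = x * poly (solA a n) z + y * poly (solB a n) z"
  by (induction n rule: induct_nat_012) (auto simp: algebra_simps diff_divide_distrib add_divide_distrib)

lemma phi_eq_sol_poly:
  "phi a T z \<mu> n = poly (sol_poly a 1 (phi a T z \<mu> 1) n) z"
proof (induction n rule: induct_nat_012)
  case (ge2 n)
  then show ?case by simp
qed simp_all

text \<open>Each transfer matrix advances the pair of values at \<open>n\<close> and
  \<open>n + 1\<close> by one site, so the columns of the product are the solutions started from the
  two unit vectors.\<close>

lemma monodromy_eq:
  "monodromy a n z = mat22 (poly (solA a n) z) (poly (solB a n) z)
     (poly (solA a (Suc n)) z) (poly (solB a (Suc n)) z)"
proof (induction n)
  case 0
  show ?case
    by (rule eq_matI) (auto simp: mat_of_rows_list_def less_Suc_eq numeral_2_eq_2)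
next
  case (Suc n)
  show ?case unfolding monodromy.simps Suc transfer_mat_def mat22_mult
    by (simp add: diff_divide_distrib add.commute)
qed

lemma cnj_sol_poly:
  assumes "z \<in> \<real>" "x \<in> \<real>" "y \<in> \<real>"
  shows "cnj (poly (sol_poly a x y n) z) = poly (sol_poly a x y n) z"
  using assms by (induction n rule: induct_nat_012) (auto simp: Reals_cnj_iff)

text \<open>The weighted Wronskian of two solutions is conserved by the recurrence. At
  \<open>n = T\<close>, where \<open>a T = a 0\<close>, this says that the monodromy matrix has
  determinant one.\<close>

lemma wronskian_sol_poly:
  assumes "\<And>n. 0 < a n"
  shows "complex_of_real (a n) * (poly (solA a n) z * poly (solB a (Suc n)) z
           - poly (solB a n) z * poly (solA a (Suc n)) z) = complex_of_real (a 0)"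
proof (induction n)
  case (Suc n)
  have "complex_of_real (a (Suc n)) \<noteq> 0" using assms[of "Suc n"] by simp
  then show ?case using Suc by (simp add: field_simps)
qed simp

text \<open>This is Green's identity for a solution and its conjugate, which solves the recurrence
  with parameter \<open>cnj z\<close>. Every site from 1 to \<open>n\<close> contributes
  \<open>Im z\<close> times a square.\<close>

lemma im_wronskian_sol_poly:
  fixes x y z :: complex
  assumes pos: "\<And>n. 0 < a n"
  defines "u \<equiv> \<lambda>n. poly (sol_poly a x y n) z"
  shows "a n * Im (u (Suc n) * cnj (u n)) =
    a 0 * Im (u 1 * cnj (u 0)) + Im z * (\<Sum>k=1..n. (cmod (u k))\<^sup>2)"
proof (induction n)
  case (Suc n)
  have "complex_of_real (a (Suc n)) * u (Suc (Suc n)) = z * u (Suc n) - complex_of_real (a n) * u n"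
    using pos[of "Suc n"] by (simp add: u_def)
  then have "Im (complex_of_real (a (Suc n)) * u (Suc (Suc n)) * cnj (u (Suc n))) =
      Im ((z * u (Suc n) - complex_of_real (a n) * u n) * cnj (u (Suc n)))" by simp
  also have "\<dots> = Im z * (cmod (u (Suc n)))\<^sup>2 + a n * Im (u (Suc n) * cnj (u n))"
    unfolding cmod_power2 by (simp add: algebra_simps power2_eq_square)
  finally show ?case using Suc by (simp add: algebra_simps)
qed simp

lemma degree_sol_poly: "degree (sol_poly a x y (Suc n)) \<le> n"
proof (induction n rule: induct_nat_012)
  case 1
  show ?case by (simp add: degree_pCons_eq_if)
next
  case (ge2 n)
  note [simp del] = sol_poly.simps(3)
  have "degree (pCons 0 (sol_poly a x y (Suc (Suc n)))) \<le> Suc (Suc n)"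
    using ge2(2) by (simp add: degree_pCons_eq_if)
  moreover have "degree (Polynomial.smult (complex_of_real (a (Suc n))) (sol_poly a x y (Suc n))) \<le> Suc (Suc n)"
    using ge2(1) degree_smult_le le_trans le_SucI by metis
  ultimately have "degree (pCons 0 (sol_poly a x y (Suc (Suc n)))
      - Polynomial.smult (complex_of_real (a (Suc n))) (sol_poly a x y (Suc n))) \<le> Suc (Suc n)"
    by (rule degree_diff_le)
  then show ?case unfolding sol_poly.simps(3)[of a x y "Suc n"]
    using degree_smult_le le_trans by blast
qed simp

text \<open>Only the shifted term reaches the top degree, so each step of the recurrence divides
  this coefficient by the next weight.\<close>

lemma coeff_solB_nonzero:
  assumes "\<And>n. 0 < a n"
  shows "coeff (solB a (Suc n)) n \<noteq> 0"
proof (induction n)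
  case (Suc n)
  have "coeff (solB a n) (Suc n) = 0"
  proof (cases n)
    case (Suc m)
    then show ?thesis using degree_sol_poly[of a 0 1 m] by (intro coeff_eq_0) simp
  qed simp
  then show ?case using Suc assms[of "Suc n"] by simp
qed simp

text \<open>The second diagonal entry has a nonzero coefficient in degree \<open>T\<close>, while
  the first has degree at most \<open>T - 1\<close>.\<close>

lemma trace_nonconstant:
  assumes "\<And>n. 0 < a n" "1 \<le> T"
  shows "0 < degree (solA a T + solB a (Suc T))"
proof -
  obtain n where T: "T = Suc n" using assms(2) by (cases T) auto
  have "coeff (solA a T) T = 0"
    using degree_sol_poly[of a 1 0 n] unfolding T by (intro coeff_eq_0) simp
  then have "coeff (solA a T + solB a (Suc T)) T \<noteq> 0"
    using coeff_solB_nonzero[OF assms(1)] by simp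
  then show ?thesis using le_degree[of _ T] assms(2) by fastforce
qed

section \<open>The elliptic set\<close>

lemma eigenvalue_monodromy_iff:
  assumes "\<And>n. 0 < a n" "a T = a 0"
  shows "eigenvalue (monodromy a T z) \<mu> \<longleftrightarrow>
    \<mu>\<^sup>2 - poly (solA a T + solB a (Suc T)) z * \<mu> + 1 = 0"
proof -
  define A B A' B' where defs: "A = poly (solA a T) z" "B = poly (solB a T) z"
    "A' = poly (solA a (Suc T)) z" "B' = poly (solB a (Suc T)) z"
  have "A * B' - B * A' = 1"
    using wronskian_sol_poly[of a T z, OF assms(1)] assms(1)[of 0] by (simp add: assms(2) defs)
  moreover have "(\<mu> - A) * (\<mu> - B') - B * A' = \<mu>\<^sup>2 - (A + B') * \<mu> + (A * B' - B * A')"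
    by (simp add: algebra_simps power2_eq_square)
  ultimately have "(\<mu> - A) * (\<mu> - B') - B * A' = \<mu>\<^sup>2 - (A + B') * \<mu> + 1" by simp
  then show ?thesis
    unfolding monodromy_eq eigenvalue_mat22_iff poly_add defs[symmetric]
    by (metis eq_iff_diff_eq_0)
qed

text \<open>A solution started from the eigenvector is multiplied by \<open>\<mu>\<close> over one
  period. Since \<open>\<mu>\<close> is unimodular, the boundary terms of Green's identity agree,
  and a nonreal \<open>z\<close> would force the solution to vanish.\<close>

lemma real_of_unimodular_eigenvalue:
  assumes pos: "\<And>n. 0 < a n" and per: "a T = a 0" and T: "1 \<le> T"
    and ev: "eigenvalue (monodromy a T z) \<mu>" and mu: "cmod \<mu> = 1"
  shows "z \<in> \<real>"
proof (rule ccontr)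
  assume "z \<notin> \<real>"
  then have im: "Im z \<noteq> 0" by (simp add: complex_is_Real_iff)
  obtain x y where xy: "x \<noteq> 0 \<or> y \<noteq> 0"
    and e: "poly (solA a T) z * x + poly (solB a T) z * y = \<mu> * x"
      "poly (solA a (Suc T)) z * x + poly (solB a (Suc T)) z * y = \<mu> * y"
    using ev unfolding monodromy_eq eigenvalue_mat22 by blast
  define u where "u n = poly (sol_poly a x y n) z" for n
  have u0: "u 0 = x" "u 1 = y" by (simp_all add: u_def)
  have uT: "u T = \<mu> * x" "u (Suc T) = \<mu> * y"
    using e unfolding u_def sol_poly_superposition[of a x y] by (simp_all add: mult.commute)
  have "u (Suc T) * cnj (u T) = (\<mu> * cnj \<mu>) * (y * cnj x)"
    unfolding uT by simp
  also have "\<mu> * cnj \<mu> = 1" using mu by (simp add: complex_norm_square[symmetric])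
  finally have "u (Suc T) * cnj (u T) = u 1 * cnj (u 0)" by (simp only: u0 mult_1_left)
  then have "Im z * (\<Sum>k=1..T. (cmod (u k))\<^sup>2) = 0"
    using im_wronskian_sol_poly[of a T x y z, OF pos] per unfolding u_def by simp
  then have "(\<Sum>k=1..T. (cmod (u k))\<^sup>2) = 0" using im by simp
  then have z: "\<forall>k\<in>{1..T}. u k = 0" by (subst (asm) sum_nonneg_eq_0_iff) auto
  \<comment> \<open>The sum omits site 0, but site \<open>T\<close> stands in for it:
    \<open>u T = \<mu> * x\<close> with \<open>\<mu>\<close> nonzero.\<close>
  have "u 1 = 0" "u T = 0" using z T by auto
  then show False using u0 uT xy mu by auto
qed

lemma quadratic_unit_product:
  fixes k x y :: complex
  assumes "x * y = 1"
  shows "k\<^sup>2 - (x + y) * k + 1 = (k - x) * (k - y)"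
  unfolding assms[symmetric] by (simp add: algebra_simps power2_eq_square)

lemma quadratic_roots_unit_product:
  fixes k l t :: complex
  assumes "k \<noteq> l" "k\<^sup>2 - t * k + 1 = 0" "l\<^sup>2 - t * l + 1 = 0"
  shows "t = k + l" "k * l = 1"
proof -
  have "(k - l) * (k + l - t) = (k\<^sup>2 - t * k + 1) - (l\<^sup>2 - t * l + 1)"
    by (simp add: algebra_simps power2_eq_square)
  then have "(k - l) * (k + l - t) = 0" unfolding assms(2,3) by simp
  then show t: "t = k + l" using assms(1) by simp
  show "k * l = 1" using assms(2) unfolding t by (simp add: algebra_simps power2_eq_square)
qed

lemma infinite_sigma_ell:
  assumes pos: "\<And>n. 0 < a n" and per: "a T = a 0" and T: "1 \<le> T"
  shows "infinite (sigma_ell a T)"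
proof -
  let ?tr = "solA a T + solB a (Suc T)"
  \<comment> \<open>On the open interval \<open>cos\<close> is injective, which makes the set of
    values infinite, and \<open>sin\<close> is positive, which keeps the two eigenvalues
    distinct.\<close>
  have "(\<lambda>\<theta>. complex_of_real (2 * cos \<theta>)) ` {0<..<pi} \<subseteq> poly ?tr ` sigma_ell a T"
  proof
    fix c assume "c \<in> (\<lambda>\<theta>. complex_of_real (2 * cos \<theta>)) ` {0<..<pi}"
    then obtain \<theta> where th: "0 < \<theta>" "\<theta> < pi" and c: "c = complex_of_real (2 * cos \<theta>)" by auto
    have "?tr - [:c:] = ?tr + [:- c:]" by simp
    then have "degree (?tr - [:c:]) = degree ?tr"
      using degree_add_eq_left[of "[:- c:]" ?tr] trace_nonconstant[of a T, OF pos T]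
      by (metis degree_pCons_0)
    then have "\<not> constant (poly (?tr - [:c:]))"
      using trace_nonconstant[of a T, OF pos T] by (simp add: constant_degree)
    then obtain z where z: "poly ?tr z = c"
      using fundamental_theorem_of_algebra by fastforce
    have cis: "c = cis \<theta> + cis (- \<theta>)" "cis \<theta> * cis (- \<theta>) = 1"
      by (simp_all add: c complex_eq_iff cis_mult)
    have "eigenvalue (monodromy a T z) (cis \<theta>)" "eigenvalue (monodromy a T z) (cis (- \<theta>))"
      unfolding eigenvalue_monodromy_iff[of a T z, OF pos per] z cis(1)
        quadratic_unit_product[OF cis(2)] by simp_all
    moreover have "cis \<theta> \<noteq> cis (- \<theta>)"
      using sin_gt_zero[OF th] by (auto simp: complex_eq_iff)
    ultimately have "z \<in> sigma_ell a T" unfolding sigma_ell_def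
      using norm_cis by blast
    then show "c \<in> poly ?tr ` sigma_ell a T" using z by blast
  qed
  moreover have "inj_on (\<lambda>\<theta>. complex_of_real (2 * cos \<theta>)) {0<..<pi}"
    by (intro inj_onI) (auto intro: cos_inj_pi)
  then have "infinite ((\<lambda>\<theta>. complex_of_real (2 * cos \<theta>)) ` {0<..<pi})"
    using pi_gt_zero by (simp add: finite_image_iff)
  ultimately show ?thesis using finite_subset by blast
qed

text \<open>The two unimodular eigenvalues have product one, so they are conjugate, and being all
  roots of the characteristic equation they include \<open>\<mu>\<close>.\<close>

lemma sigma_ell_eigenvalue:
  assumes pos: "\<And>n. 0 < a n" and per: "a T = a 0" and T: "1 \<le> T"
    and z: "z \<in> sigma_ell a T" and ev: "eigenvalue (monodromy a T z) \<mu>"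
  shows "z \<in> \<real>" "\<mu> * cnj \<mu> = 1" "\<mu> + cnj \<mu> = poly (solA a T + solB a (Suc T)) z"
    "poly (solB a T) z \<noteq> 0"
proof -
  let ?tr = "poly (solA a T + solB a (Suc T)) z"
  obtain k l where kl: "k \<noteq> l" "cmod k = 1" "cmod l = 1"
    "eigenvalue (monodromy a T z) k" "eigenvalue (monodromy a T z) l"
    using z unfolding sigma_ell_def by blast
  note iff = eigenvalue_monodromy_iff[of a T z, OF pos per]
  show real: "z \<in> \<real>"
    using real_of_unimodular_eigenvalue[of a T z k, OF pos per T kl(4,2)] .
  have k: "k\<^sup>2 - ?tr * k + 1 = 0" and l: "l\<^sup>2 - ?tr * l + 1 = 0" and m: "\<mu>\<^sup>2 - ?tr * \<mu> + 1 = 0"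
    using kl(4,5) ev unfolding iff by blast+
  note tr = quadratic_roots_unit_product(1)[OF kl(1) k l]
    and kl1 = quadratic_roots_unit_product(2)[OF kl(1) k l]
  have "k * cnj k = 1" using kl(2) by (simp add: complex_norm_square[symmetric])
  then have l_eq: "l = cnj k" using kl1 kl(2) by (metis mult_cancel_left mult_zero_left zero_neq_one)
  have "(\<mu> - k) * (\<mu> - l) = 0"
    using m unfolding tr quadratic_unit_product[OF kl1] .
  then have mu: "\<mu> = k \<or> \<mu> = l" by simp
  show "\<mu> * cnj \<mu> = 1" "\<mu> + cnj \<mu> = ?tr"
    using mu kl1 unfolding tr l_eq by (auto simp: ac_simps)
  show "poly (solB a T) z \<noteq> 0"
  proof
    \<comment> \<open>The monodromy matrix would be triangular with real diagonal, so
      \<open>k\<close> would be real and equal to its conjugate \<open>l\<close>.\<close>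
    assume B: "poly (solB a T) z = 0"
    have "k = poly (solA a T) z \<or> k = poly (solB a (Suc T)) z"
      using kl(4) unfolding monodromy_eq eigenvalue_mat22_iff B by simp
    then have "cnj k = k" using cnj_sol_poly[OF real] by auto
    then show False using kl(1) l_eq by simp
  qed
qed

section \<open>Rational functions\<close>

text \<open>The value may come from another representation, so the two fractions are
  cross-multiplied. The multiplied-out form also covers points where \<open>q\<close>
  vanishes.\<close>

lemma rat_has_value_Fract:
  assumes "q \<noteq> 0" "rat_has_value (Fract p q) z w"
  shows "w * poly q z = poly p z"
proof -
  obtain p' q' where e: "Fract p q = Fract p' q'" and q': "poly q' z \<noteq> 0"
    and w: "w = poly p' z / poly q' z"
    using assms(2) unfolding rat_has_value_def by blast
  have "q' \<noteq> 0" using q' by auto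
  then have "p * q' = p' * q" using e assms(1) by (simp add: eq_fract)
  then have "poly p z * poly q' z = poly p' z * poly q z" by (metis poly_mult)
  moreover have "poly p' z = w * poly q' z" using q' w by simp
  ultimately have "(w * poly q z) * poly q' z = poly p z * poly q' z"
    by (metis mult.assoc mult.commute)
  then show ?thesis using q' by simp
qed

text \<open>The numerator of the difference is a polynomial vanishing on an infinite set, hence
  zero.\<close>

lemma rat_fun_eqI:
  assumes "infinite S"
    and "\<And>z. z \<in> S \<Longrightarrow> \<exists>w. rat_has_value R z w \<and> rat_has_value R' z w"
  shows "R = R'"
proof -
  obtain p q where R: "R = Fract p q" "q \<noteq> 0" by (cases R)
  obtain p' q' where R': "R' = Fract p' q'" "q' \<noteq> 0" by (cases R')
  have "poly (p * q' - p' * q) z = 0" if z: "z \<in> S" for z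
  proof -
    obtain w where "rat_has_value R z w" "rat_has_value R' z w" using assms(2)[OF z] by blast
    then have w: "poly p z = w * poly q z" "poly p' z = w * poly q' z"
      using R R' rat_has_value_Fract by metis+
    show ?thesis by (simp add: w)
  qed
  then have "S \<subseteq> {z. poly (p * q' - p' * q) z = 0}" by blast
  then have "p * q' - p' * q = 0"
    using assms(1) finite_subset poly_roots_finite by blast
  then show ?thesis using R R' by (simp add: eq_fract)
qed

section \<open>The rational extension\<close>

text \<open>The numerator over the denominator \<open>2 * solB a T\<close>: the factor 2 clears the
  half in the real part, and \<open>solB a T\<close> clears the denominators of the trace and the
  norm of \<open>phi\<close> at 1.\<close>

definition C_num :: "(nat \<Rightarrow> real) \<Rightarrow> nat \<Rightarrow> complex poly" where
  "C_num a T = (\<Sum>s=1..T.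
     2 * solB a T * (solA a s * solA a (s - 1))
     + (solB a (Suc T) - solA a T) * (solA a s * solB a (s - 1) + solB a s * solA a (s - 1))
     - 2 * solA a (Suc T) * (solB a s * solB a (s - 1)))"

lemma C_fun_eq:
  assumes pos: "\<And>n. 0 < a n" and per: "a T = a 0" and T: "1 \<le> T"
    and z: "z \<in> sigma_ell a T" and ev: "eigenvalue (monodromy a T z) \<mu>"
  shows "complex_of_real (C_fun a T z \<mu>) = poly (C_num a T) z / poly (2 * solB a T) z"
proof -
  note props = sigma_ell_eigenvalue[of a T z \<mu>, OF pos per T z ev]
  define A where "A n = poly (solA a n) z" for n
  define B where "B n = poly (solB a n) z" for n
  have cnjA: "cnj (A n) = A n" and cnjB: "cnj (B n) = B n" for n
    unfolding A_def B_def using cnj_sol_poly[OF props(1)] by simp_all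
  have B0: "B T \<noteq> 0" using props(4) by (simp add: B_def)
  have tr: "\<mu> + cnj \<mu> = A T + B (Suc T)" using props(3) by (simp add: A_def B_def)
  define f where "f = phi a T z \<mu> 1"
  have f: "B T * f = \<mu> - A T"
    using B0 by (simp add: f_def monodromy_eq mat_of_rows_list_def A_def B_def)
  have cf: "B T * cnj f = cnj \<mu> - A T"
    using arg_cong[OF f, of cnj] by (simp add: cnjA cnjB)
  have sum_f: "B T * (f + cnj f) = B (Suc T) - A T"
    using tr unfolding distrib_left f cf by (simp add: algebra_simps)
  have det: "A T * B (Suc T) - B T * A (Suc T) = 1"
    using wronskian_sol_poly[of a T z, OF pos] pos[of 0] by (simp add: per A_def B_def)
  \<comment> \<open>Determinant one turns the right-hand side into a multiple of \<open>B T\<close>,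
    so one factor \<open>B T\<close> cancels.\<close>
  have "B T * (B T * (f * cnj f)) = (\<mu> - A T) * (cnj \<mu> - A T)"
    unfolding f[symmetric] cf[symmetric] by (simp add: ac_simps)
  also have "\<dots> = \<mu> * cnj \<mu> - A T * (\<mu> + cnj \<mu>) + A T * A T"
    by (simp add: algebra_simps)
  also have "\<dots> = B T * (- A (Suc T))"
    unfolding props(2) tr using det by (simp add: algebra_simps)
  finally have prod_f: "B T * (f * cnj f) = - A (Suc T)"
    using B0 by (simp only: mult_cancel_left simp_thms)
  have phi: "phi a T z \<mu> n = A n + f * B n" for n
    unfolding phi_eq_sol_poly[of a T z \<mu> n] f_def A_def B_def
    by (subst sol_poly_superposition) simp
  have summand: "2 * B T * complex_of_real (Re (phi a T z \<mu> s * cnj (phi a T z \<mu> t))) =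
      2 * B T * (A s * A t) + (B (Suc T) - A T) * (A s * B t + B s * A t)
      - 2 * A (Suc T) * (B s * B t)" for s t
  proof -
    \<comment> \<open>Twice the real part is the product plus its conjugate. As \<open>A\<close> and
      \<open>B\<close> are real here, conjugation only exchanges \<open>f\<close> and
      \<open>cnj f\<close>, so the sum is symmetric in them.\<close>
    have "2 * complex_of_real (Re (phi a T z \<mu> s * cnj (phi a T z \<mu> t))) =
        (A s + f * B s) * (A t + cnj f * B t) + (A s + cnj f * B s) * (A t + f * B t)"
      using complex_add_cnj[of "phi a T z \<mu> s * cnj (phi a T z \<mu> t)"]
      by (simp add: phi cnjA cnjB)
    then have "2 * B T * complex_of_real (Re (phi a T z \<mu> s * cnj (phi a T z \<mu> t))) =
        B T * ((A s + f * B s) * (A t + cnj f * B t) + (A s + cnj f * B s) * (A t + f * B t))"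
      by (metis mult.assoc mult.commute)
    also have "\<dots> = 2 * B T * (A s * A t) + (B T * (f + cnj f)) * (A s * B t + B s * A t)
        + 2 * (B T * (f * cnj f)) * (B s * B t)"
      by (simp add: algebra_simps)
    finally show ?thesis unfolding sum_f prod_f by simp
  qed
  have "2 * B T * complex_of_real (C_fun a T z \<mu>) =
      (\<Sum>s=1..T. 2 * B T * complex_of_real (Re (phi a T z \<mu> s * cnj (phi a T z \<mu> (s - 1)))))"
    unfolding C_fun_def Re_sum of_real_sum sum_distrib_left ..
  also have "\<dots> = poly (C_num a T) z"
    unfolding summand C_num_def poly_sum by (simp add: A_def B_def)
  finally show ?thesis using B0 by (simp add: B_def field_simps)
qed

theorem lemma4p3:
  fixes a :: "nat \<Rightarrow> real" and T :: nat
  assumes "1 \<le> T"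
    and "\<forall>j\<in>{1..T}. 0 < a j"
    and "\<forall>n. a (n + T) = a n"
  shows "\<exists>!R :: rat_fun. \<forall>z\<in>sigma_ell a T. \<forall>\<mu>.
           eigenvalue (monodromy a T z) \<mu> \<longrightarrow>
             rat_has_value R z (complex_of_real (C_fun a T z \<mu>))"
proof -
  have per: "a T = a 0" using assms(3)[rule_format, of 0] by simp
  \<comment> \<open>Index 0 is moved to \<open>T\<close> by periodicity, and an index beyond
    \<open>T\<close> is lowered by one period.\<close>
  have pos: "0 < a n" for n
  proof (induction n rule: less_induct)
    case (less n)
    consider "n = 0" | "n \<in> {1..T}" | "T < n" by force
    then show ?case
    proof cases
      case 1
      then show ?thesis using per assms(1,2) by (metis atLeastAtMost_iff order_refl)
    next
      case 3
      then show ?thesis using less[of "n - T"] assms(3)[rule_format, of "n - T"] assms(1) by simp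
    qed (use assms(2) in simp)
  qed
  show ?thesis
  proof (rule ex_ex1I)
    have "rat_has_value (Fract (C_num a T) (2 * solB a T)) z (complex_of_real (C_fun a T z \<mu>))"
      if "z \<in> sigma_ell a T" "eigenvalue (monodromy a T z) \<mu>" for z \<mu>
    proof -
      have "poly (2 * solB a T) z \<noteq> 0"
        using sigma_ell_eigenvalue(4)[of a T z \<mu>, OF pos per assms(1) that] by simp
      then show ?thesis unfolding rat_has_value_def
        using C_fun_eq[of a T z \<mu>, OF pos per assms(1) that] by blast
    qed
    then show "\<exists>R. \<forall>z\<in>sigma_ell a T. \<forall>\<mu>. eigenvalue (monodromy a T z) \<mu> \<longrightarrow>
        rat_has_value R z (complex_of_real (C_fun a T z \<mu>))" by blast
  next
    fix R R' :: rat_fun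
    assume h: "\<forall>z\<in>sigma_ell a T. \<forall>\<mu>. eigenvalue (monodromy a T z) \<mu> \<longrightarrow>
        rat_has_value R z (complex_of_real (C_fun a T z \<mu>))"
      "\<forall>z\<in>sigma_ell a T. \<forall>\<mu>. eigenvalue (monodromy a T z) \<mu> \<longrightarrow>
        rat_has_value R' z (complex_of_real (C_fun a T z \<mu>))"
    show "R = R'"
    proof (rule rat_fun_eqI[OF infinite_sigma_ell[of a T, OF pos per assms(1)]])
      fix z assume z: "z \<in> sigma_ell a T"
      \<comment> \<open>An eigenvalue exists at every elliptic point, so the condition on
        \<open>R\<close> and \<open>R'\<close> is never vacuous there and gives them a common
        value.\<close>
      then obtain \<mu> where "eigenvalue (monodromy a T z) \<mu>" unfolding sigma_ell_def by blast
      then show "\<exists>w. rat_has_value R z w \<and> rat_has_value R' z w" using h z by blast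
    qed
  qed
qed

end
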